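(* Let $\Sigma$ be a finite set. If $f: \Sigma^n \to \mathbb{C}$ satisfies $\|f\|_2 \le 1$ and $\mathsf{swap}(f) \ge 1-c$ for some $0\le c\leq 0.05$, then there are $P_1, \dots, P_n: \Sigma \to \mathbb{C}$ with $\|P_i\|_2 = 1$ such that $|\langle f, P_1\cdots P_n\rangle| \ge 1-O(c)$, where $(P_1\cdots P_n)(x)=\prod_i P_i(x_i)$ and $O(\cdot)$ hides an absolute constant.
   Context: Norms and inner products are with respect to uniform measures: $\|u\|_2=(\mathbb{E}|u|^2)^{1/2}$, $\langle u,v\rangle=\mathbb{E}_{x\sim\Sigma^n}[u(x)\overline{v(x)}]$. $\mathsf{swap}(f)=\mathbb{E}[f(x)f(y)\overline{f(x')f(y')}]$ where $x,y\in\Sigma^n$ are uniform and independent and, independently for each coordinate $i$, $(x'_i,y'_i)$ equals $(x_i,y_i)$ or $(y_i,x_i)$ with probability $1/2$ each. *)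

theory Defs imports "HOL-Probability.Probability" begin

definition unif_expectation :: "'b set \<Rightarrow> ('b \<Rightarrow> 'c::{banach, second_countable_topology}) \<Rightarrow> 'c" where
  "unif_expectation A u = measure_pmf.expectation (pmf_of_set A) u"

definition l2_norm :: "'b set \<Rightarrow> ('b \<Rightarrow> complex) \<Rightarrow> real" where
  "l2_norm A u = sqrt (unif_expectation A (\<lambda>x. (cmod (u x))\<^sup>2))"

definition l2_inner :: "'b set \<Rightarrow> ('b \<Rightarrow> complex) \<Rightarrow> ('b \<Rightarrow> complex) \<Rightarrow> complex" where
  "l2_inner A u v = unif_expectation A (\<lambda>x. u x * cnj (v x))"

text \<open>Tuples are indexed by \<open>0, \<dots>, n - 1\<close> and are \<open>undefined\<close> at all other indices.
  The alphabet is a finite set rather than a finite type so that a constant can be quantified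
  before it; taking \<open>nat\<close> for \<open>'a\<close> covers all finite alphabets up to bijection.\<close>

definition tuples :: "'a set \<Rightarrow> nat \<Rightarrow> (nat \<Rightarrow> 'a) set" where
  "tuples \<Sigma> n = {..<n} \<rightarrow>\<^sub>E \<Sigma>"

text \<open>\<open>mix b x y\<close> takes coordinate \<open>i\<close> from \<open>y\<close> if \<open>b i\<close> and from \<open>x\<close> otherwise, so
  \<open>(mix b x y, mix b y x)\<close> is \<open>(x, y)\<close> with exactly the coordinates in \<open>{i. b i}\<close> exchanged.\<close>

definition mix :: "(nat \<Rightarrow> bool) \<Rightarrow> (nat \<Rightarrow> 'a) \<Rightarrow> (nat \<Rightarrow> 'a) \<Rightarrow> nat \<Rightarrow> 'a" where
  "mix b x y = (\<lambda>i. if b i then y i else x i)"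

definition swap_pmf :: "'a set \<Rightarrow> nat \<Rightarrow> ((nat \<Rightarrow> 'a) \<times> (nat \<Rightarrow> 'a) \<times> (nat \<Rightarrow> bool)) pmf" where
  "swap_pmf \<Sigma> n = pair_pmf (pmf_of_set (tuples \<Sigma> n))
     (pair_pmf (pmf_of_set (tuples \<Sigma> n)) (Pi_pmf {..<n} False (\<lambda>_. bernoulli_pmf (1/2))))"

definition swap :: "'a set \<Rightarrow> nat \<Rightarrow> ((nat \<Rightarrow> 'a) \<Rightarrow> complex) \<Rightarrow> complex" where
  "swap \<Sigma> n f = measure_pmf.expectation (swap_pmf \<Sigma> n)
     (\<lambda>(x, y, b). f x * f y * cnj (f (mix b x y) * f (mix b y x)))"

lemma map_swap_pmf:
  assumes "finite \<Sigma>" "\<Sigma> \<noteq> {}"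
  shows "map_pmf (\<lambda>(x, y, b). (mix b x y, mix b y x, b)) (swap_pmf \<Sigma> n) = swap_pmf \<Sigma> n"
proof -
  let ?T = "tuples \<Sigma> n" and ?B = "Pi_pmf {..<n} False (\<lambda>_. bernoulli_pmf (1/2))"
  have fin: "finite ?T" "?T \<noteq> {}"
    using assms by (auto simp: tuples_def PiE_eq_empty_iff intro!: finite_PiE)
  have pr: "pair_pmf (pmf_of_set ?T) (pmf_of_set ?T) = pmf_of_set (?T \<times> ?T)"
  proof (rule pmf_eqI)
    fix z :: "(nat \<Rightarrow> 'a) \<times> (nat \<Rightarrow> 'a)"
    obtain x y where z: "z = (x, y)" by (cases z)
    have fin2: "?T \<times> ?T \<noteq> {}" "finite (?T \<times> ?T)"
      using fin by auto
    show "pmf (pair_pmf (pmf_of_set ?T) (pmf_of_set ?T)) z = pmf (pmf_of_set (?T \<times> ?T)) z"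
      unfolding z pmf_pair pmf_of_set [OF fin(2,1)] pmf_of_set [OF fin2]
      by (simp add: card_cartesian_product indicator_def)
  qed
  have eq: "swap_pmf \<Sigma> n = ?B \<bind> (\<lambda>b. map_pmf (\<lambda>(x, y). (x, y, b)) (pmf_of_set (?T \<times> ?T)))"
  proof -
    have "swap_pmf \<Sigma> n = map_pmf (\<lambda>((x, y), b). (x, y, b)) (pair_pmf (pmf_of_set (?T \<times> ?T)) ?B)"
      unfolding swap_pmf_def pr [symmetric]
      by (simp only: pair_pmf_def map_pmf_def bind_assoc_pmf bind_return_pmf case_prod_conv)
    also have "\<dots> = ?B \<bind> (\<lambda>b. map_pmf (\<lambda>(x, y). (x, y, b)) (pmf_of_set (?T \<times> ?T)))"
      unfolding pair_pmf_def map_pmf_def bind_assoc_pmf bind_return_pmf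
      by (subst bind_commute_pmf) (simp only: case_prod_unfold fst_conv snd_conv)
    finally show ?thesis .
  qed
  have mm: "mix b (mix b x y) (mix b y x) = x" for b and x y :: "nat \<Rightarrow> 'a"
    by (auto simp: mix_def)
  have mT: "mix b x y \<in> ?T" if "x \<in> ?T" "y \<in> ?T" for b x y
    using that unfolding tuples_def mix_def PiE_iff extensional_def by simp
  have bij: "bij_betw (\<lambda>(x, y). (mix b x y, mix b y x)) (?T \<times> ?T) (?T \<times> ?T)" for b
    by (rule bij_betw_byWitness[where f' = "\<lambda>(x, y). (mix b x y, mix b y x)"])
       (simp_all add: mm mT image_subset_iff split: prod.split)
  have m: "map_pmf (\<lambda>(x, y). (mix b x y, mix b y x)) (pmf_of_set (?T \<times> ?T)) = pmf_of_set (?T \<times> ?T)" for b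
    by (rule map_pmf_of_set_bij_betw [OF bij]) (use fin in auto)
  have "map_pmf (\<lambda>(x, y, b). (mix b x y, mix b y x, b)) (swap_pmf \<Sigma> n)
      = ?B \<bind> (\<lambda>b. map_pmf (\<lambda>(x, y). (x, y, b))
          (map_pmf (\<lambda>(x, y). (mix b x y, mix b y x)) (pmf_of_set (?T \<times> ?T))))"
    unfolding eq map_bind_pmf pmf.map_comp by (simp add: o_def case_prod_unfold)
  also have "\<dots> = swap_pmf \<Sigma> n"
    unfolding m by (rule eq [symmetric])
  finally show ?thesis .
qed

text \<open>\<open>swap\<close> is an expectation of complex values, but it is a real number.\<close>

lemma swap_real:
  assumes "finite \<Sigma>" "\<Sigma> \<noteq> {}"
  shows "swap \<Sigma> n f \<in> \<real>"
proof -
  have mm: "mix b (mix b x y) (mix b y x) = x" for b and x y :: "nat \<Rightarrow> 'a"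
    by (auto simp: mix_def)
  have "swap \<Sigma> n f = measure_pmf.expectation
      (map_pmf (\<lambda>(x, y, b). (mix b x y, mix b y x, b)) (swap_pmf \<Sigma> n))
      (\<lambda>(x, y, b). f x * f y * cnj (f (mix b x y) * f (mix b y x)))"
    by (simp only: map_swap_pmf [OF assms] swap_def)
  also have "\<dots> = measure_pmf.expectation (swap_pmf \<Sigma> n)
      (\<lambda>z. cnj (case z of (x, y, b) \<Rightarrow> f x * f y * cnj (f (mix b x y) * f (mix b y x))))"
    unfolding integral_map_pmf
    by (rule Bochner_Integration.integral_cong) (auto simp: mm)
  also have "\<dots> = cnj (swap \<Sigma> n f)"
    unfolding swap_def by (rule Bochner_Integration.integral_cnj)
  finally show ?thesis by (simp add: Reals_cnj_iff)
qed

end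

theory Submission imports Defs begin

text \<open>For a unit vector \<open>f\<close> in \<open>\<ell>\<^sup>2(\<Sigma>\<^sup>n)\<close>, \<open>swap f\<close> is the average over \<open>S \<subseteq> [n]\<close> of the purity of \<open>f\<close> across the
  cut \<open>S\<close>. Let \<open>f\<^sub>z\<close> be the slices of \<open>f\<close> at the last coordinate and \<open>v\<close> a unit vector maximising
  \<open>M = \<Sum>\<^sub>z \<bar>\<langle>f\<^sub>z, v\<rangle>\<bar>\<^sup>2\<close>, that is, a top Schmidt vector of \<open>f\<close>. With \<open>N(u, v)\<close> the exchange average of
  \<open>u \<otimes> v\<close>, one has \<open>swap f = \<Sum>\<^sub>z\<^sub>w N(f\<^sub>z, f\<^sub>w)\<close> and \<open>N(u, v) \<le> (\<parallel>u\<parallel>\<^sup>2 \<parallel>v\<parallel>\<^sup>2 + \<bar>\<langle>u, v\<rangle>\<bar>\<^sup>2) / 2\<close>. This gives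
  \<open>1 - M \<le> 2 (1 - swap f)\<close>, and, after splitting off the \<open>v\<close>-component of every slice,
  \<open>swap f \<le> M\<^sup>2 swap v + (1 - M)\<close>. So when passing from \<open>f\<close> to \<open>v\<close> the defect \<open>1 - swap\<close> drops by at least
  \<open>(1 - M) / 2\<close>, which pays for the factor \<open>M\<close> lost in the squared overlap: by induction some product
  vector has squared overlap at least \<open>1 - 2 (1 - swap f)\<close> with \<open>f\<close>.\<close>

section \<open>Sums in place of expectations, and the top singular vector\<close>

definition ip :: "'b set \<Rightarrow> ('b \<Rightarrow> complex) \<Rightarrow> ('b \<Rightarrow> complex) \<Rightarrow> complex" where
  "ip A u v = (\<Sum>x\<in>A. u x * cnj (v x))"

text \<open>Like \<open>ip\<close>, a plain sum over \<open>A\<close>: contributions of slices then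
  add up without normalising factors, which return in \<open>l2_norm_eq\<close> and
  \<open>l2_inner_eq\<close>.\<close>

definition normsq :: "'b set \<Rightarrow> ('b \<Rightarrow> complex) \<Rightarrow> real" where
  "normsq A u = (\<Sum>x\<in>A. (cmod (u x))\<^sup>2)"

lemma normsq_nonneg [simp]: "0 \<le> normsq A u"
  by (simp add: normsq_def sum_nonneg)

lemma normsq_scale: "normsq A (\<lambda>x. k * u x) = (cmod k)\<^sup>2 * normsq A u"
  by (simp add: normsq_def norm_mult power_mult_distrib sum_distrib_left)

lemma ip_scale_right: "ip A u (\<lambda>x. k * v x) = cnj k * ip A u v"
  by (simp add: ip_def sum_distrib_left ac_simps)

lemma cnj_ip: "cnj (ip A u v) = ip A v u"
  by (simp add: ip_def mult.commute)

lemma ip_self: "ip A u u = of_real (normsq A u)"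
  by (simp add: ip_def normsq_def complex_norm_square del: of_real_power)

lemma ip_Cauchy_Schwarz: "(cmod (ip A u v))\<^sup>2 \<le> normsq A u * normsq A v"
proof -
  have "cmod (ip A u v) \<le> (\<Sum>x\<in>A. cmod (u x) * cmod (v x))"
    unfolding ip_def by (rule order_trans[OF norm_sum]) (simp add: norm_mult)
  then have "(cmod (ip A u v))\<^sup>2 \<le> (\<Sum>x\<in>A. cmod (u x) * cmod (v x))\<^sup>2"
    by (rule power_mono) simp
  also have "\<dots> \<le> normsq A u * normsq A v"
    unfolding normsq_def by (rule Cauchy_Schwarz_ineq_sum)
  finally show ?thesis .
qed

text \<open>Vanishing off \<open>A\<close> places the sphere in a product of discs and singletons,
  compact by Tychonoff; \<open>normsq\<close> is continuous for the product topology.\<close>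

lemma compact_unit_sphere:
  assumes "finite A"
  shows "compact {v :: 'b \<Rightarrow> complex. (\<forall>x. x \<notin> A \<longrightarrow> v x = 0) \<and> normsq A v = 1}" (is "compact ?S")
proof -
  let ?B = "\<lambda>x. if x \<in> A then cball (0::complex) 1 else {0}"
  have "compactin (product_topology (\<lambda>_. euclidean) UNIV) (Pi\<^sub>E UNIV ?B)"
    by (subst compactin_PiE) (auto simp del: euclidean_product_topology)
  then have cB: "compact (Pi\<^sub>E UNIV ?B)"
    by (simp add: euclidean_product_topology)
  have cl: "closed {v :: 'b \<Rightarrow> complex. normsq A v = 1}"
    unfolding normsq_def by (intro closed_Collect_eq continuous_intros continuous_on_product_coordinates)
  have "cmod (v x) \<le> 1" if "normsq A v = 1" "x \<in> A" for v x
  proof -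
    have "(cmod (v x))\<^sup>2 \<le> normsq A v"
      unfolding normsq_def using assms that by (intro member_le_sum) auto
    then show ?thesis using that by (simp add: abs_square_le_1)
  qed
  then have "?S = Pi\<^sub>E UNIV ?B \<inter> {v. normsq A v = 1}"
    by (auto simp: PiE_iff Pi_iff split: if_splits)
  then show ?thesis using compact_Int_closed[OF cB cl] by simp
qed

text \<open>The form being maximised is <K w, w>, where K w is the sum over \<open>z\<close> of
  \<open>cnj (ip A (F z) w) * F z\<close>. By first-order optimality a maximiser on the sphere is an
  eigenvector of K for the maximal value \<open>M\<close>.\<close>

lemma exists_top_singular_vector:
  fixes F :: "'a \<Rightarrow> 'b \<Rightarrow> complex"
  assumes "finite A" "A \<noteq> {}" "finite Z"
  obtains v M where "normsq A v = 1" "(\<Sum>z\<in>Z. (cmod (ip A (F z) v))\<^sup>2) = M"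
    "\<And>w. (\<Sum>z\<in>Z. (cmod (ip A (F z) w))\<^sup>2) \<le> M * normsq A w"
    "\<And>x. x \<in> A \<Longrightarrow> (\<Sum>z\<in>Z. cnj (ip A (F z) v) * F z x) = of_real M * v x"
proof -
  let ?S = "{v :: 'b \<Rightarrow> complex. (\<forall>x. x \<notin> A \<longrightarrow> v x = 0) \<and> normsq A v = 1}"
  define q where "q w = (\<Sum>z\<in>Z. (cmod (ip A (F z) w))\<^sup>2)" for w
  obtain a where a: "a \<in> A" using assms by blast
  have "normsq A (\<lambda>x. if x = a then 1 else 0) = (\<Sum>x\<in>A. if x = a then 1 else 0)"
    unfolding normsq_def by (rule sum.cong) simp_all
  also have "\<dots> = 1" using a assms(1) by (subst sum.delta) simp_all
  finally have "(\<lambda>x. if x = a then 1 else 0) \<in> ?S" using a by (intro CollectI conjI allI impI) auto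
  then have ne: "?S \<noteq> {}" by (metis (no_types, lifting) empty_iff)
  have "continuous_on ?S q"
    unfolding q_def ip_def
    by (intro continuous_intros continuous_on_product_then_coordinatewise)
  from continuous_attains_sup[OF compact_unit_sphere[OF assms(1)] ne this]
  obtain v where v: "v \<in> ?S" and max: "\<And>w. w \<in> ?S \<Longrightarrow> q w \<le> q v" by blast
  define M where "M = q v"
  have q_scale: "q (\<lambda>x. k * w x) = (cmod k)\<^sup>2 * q w" for k w
    by (simp add: q_def ip_scale_right norm_mult power_mult_distrib sum_distrib_left)
  have bound: "q w \<le> M * normsq A w" for w
  proof (cases "normsq A w = 0")
    case True
    then have "ip A u w = 0" for u using ip_Cauchy_Schwarz[of A u w] by simp
    then show ?thesis using True by (simp add: q_def)
  next
    case False
    then have pos: "normsq A w > 0" using normsq_nonneg[of A w] by linarith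
    define k where "k = complex_of_real (1 / sqrt (normsq A w))"
    \<comment> \<open>Truncation to \<open>A\<close> puts the normalised \<open>w\<close> into the
      sphere without changing any sum over \<open>A\<close>.\<close>
    define w' where "w' = (\<lambda>x. if x \<in> A then k * w x else 0)"
    have k: "(cmod k)\<^sup>2 = 1 / normsq A w"
      using pos unfolding k_def norm_of_real by (simp add: power_divide)
    have "normsq A w' = normsq A (\<lambda>x. k * w x)"
      by (simp add: normsq_def w'_def)
    then have "normsq A w' = 1" using pos by (simp add: normsq_scale k)
    then have "q w' \<le> M" unfolding M_def by (intro max) (auto simp: w'_def)
    moreover have "q w' = q (\<lambda>x. k * w x)" by (simp add: q_def ip_def w'_def)
    ultimately show ?thesis using pos by (simp add: q_scale k divide_simps)
  qed
  define Kv where "Kv x = (\<Sum>z\<in>Z. cnj (ip A (F z) v) * F z x)" for x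
  define r where "r x = Kv x - of_real M * v x" for x
  have nv: "normsq A v = 1" using v by simp
  \<comment> \<open>Maximality is tested at \<open>v\<close> plus \<open>t\<close> times the
    residual \<open>r\<close> of the eigenvalue equation. Constant terms cancel; the first-order
    gain \<open>2 * t * normsq A r\<close> faces only a term quadratic in \<open>t\<close>, so small
    \<open>t\<close> forces \<open>r\<close> to vanish on \<open>A\<close>.\<close>
  have main: "2 * t * normsq A r \<le> t\<^sup>2 * (M * normsq A r - q r)" for t :: real
  proof -
    define w where "w x = v x + of_real t * r x" for x
    have ipw: "ip A u w = ip A u v + of_real t * ip A u r" for u
      by (simp add: ip_def w_def algebra_simps sum.distrib sum_distrib_left)
    have sq: "(cmod (a + of_real t * b))\<^sup>2 = (cmod a)\<^sup>2 + 2 * t * Re (cnj a * b) + t\<^sup>2 * (cmod b)\<^sup>2" for a b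
      unfolding cmod_power2 by (simp add: algebra_simps power2_eq_square)
    have "(\<Sum>z\<in>Z. cnj (ip A (F z) v) * ip A (F z) r) = ip A Kv r"
      unfolding ip_def[of A "F _" r] ip_def[of A Kv r] Kv_def sum_distrib_left sum_distrib_right
      by (subst sum.swap) (simp add: mult.assoc)
    then have "Re (ip A Kv r) = (\<Sum>z\<in>Z. Re (cnj (ip A (F z) v) * ip A (F z) r))"
      by (simp only: flip: Re_sum)
    then have qw: "q w = q v + 2 * t * Re (ip A Kv r) + t\<^sup>2 * q r"
      unfolding q_def ipw sq by (simp only: sum.distrib sum_distrib_left)
    have nw: "normsq A w = normsq A v + 2 * t * Re (ip A v r) + t\<^sup>2 * normsq A r"
    proof -
      have "Re (ip A v r) = (\<Sum>x\<in>A. Re (cnj (v x) * r x))" by (simp add: ip_def)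
      then show ?thesis
        unfolding normsq_def w_def sq by (simp only: sum.distrib sum_distrib_left)
    qed
    have res: "Re (ip A Kv r) - M * Re (ip A v r) = normsq A r"
    proof -
      have "ip A Kv r - of_real M * ip A v r = ip A r r"
        unfolding ip_def sum_distrib_left sum_subtractf[symmetric]
        by (intro sum.cong refl) (simp add: r_def algebra_simps)
      from arg_cong[OF this, of Re] show ?thesis by (simp add: ip_self)
    qed
    have "2 * t * normsq A r = 2 * t * Re (ip A Kv r) - M * (2 * t * Re (ip A v r))"
      by (simp flip: res add: algebra_simps)
    then show ?thesis
      using bound[of w] unfolding qw nw nv M_def[symmetric] by (simp add: algebra_simps)
  qed
  have "normsq A r = 0"
  proof (rule ccontr)
    assume "normsq A r \<noteq> 0"
    then have N: "normsq A r > 0" using normsq_nonneg[of A r] by linarith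
    define D where "D = M * normsq A r - q r"
    have D: "D \<ge> 0" using bound[of r] by (simp add: D_def)
    \<comment> \<open>Small enough that \<open>t * D\<close> is at most \<open>normsq A r\<close>;
      the summand 1 covers \<open>D = 0\<close>.\<close>
    define t where "t = normsq A r / (D + 1)"
    have t: "t > 0" using N D by (simp add: t_def)
    have "2 * t * normsq A r \<le> t * (t * D)"
      using main[of t] by (simp add: D_def power2_eq_square mult.assoc)
    then have "2 * normsq A r \<le> t * D" using t by simp
    also have "\<dots> \<le> normsq A r" using N D by (simp add: t_def divide_simps algebra_simps)
    finally show False using N by simp
  qed
  then have "r x = 0" if "x \<in> A" for x
    using that assms by (simp add: normsq_def sum_nonneg_eq_0_iff)
  then have eig: "\<And>x. x \<in> A \<Longrightarrow> (\<Sum>z\<in>Z. cnj (ip A (F z) v) * F z x) = of_real M * v x"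
    by (simp add: r_def Kv_def)
  show thesis
    by (rule that[of v M]) (use nv eig bound in \<open>simp_all add: M_def q_def\<close>)
qed


section \<open>Exchange sums and their averages\<close>

definition exch :: "'a set \<Rightarrow> nat \<Rightarrow> nat set \<Rightarrow> ((nat \<Rightarrow> 'a) \<Rightarrow> complex) \<Rightarrow> ((nat \<Rightarrow> 'a) \<Rightarrow> complex) \<Rightarrow> complex" where
  "exch \<Sigma> n S u v = (\<Sum>x\<in>tuples \<Sigma> n. \<Sum>y\<in>tuples \<Sigma> n.
     u x * v y * cnj (u (mix (\<lambda>i. i \<in> S) x y) * v (mix (\<lambda>i. i \<in> S) y x)))"

text \<open>The N of the overview. The uniform subset \<open>S\<close> stands for the fair bits of
  \<open>swap_pmf\<close>; \<open>swap_eq_exch_avg\<close> makes the link.\<close>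

definition exch_avg :: "'a set \<Rightarrow> nat \<Rightarrow> ((nat \<Rightarrow> 'a) \<Rightarrow> complex) \<Rightarrow> ((nat \<Rightarrow> 'a) \<Rightarrow> complex) \<Rightarrow> complex" where
  "exch_avg \<Sigma> n u v = (\<Sum>S\<in>Pow {..<n}. exch \<Sigma> n S u v) / 2 ^ n"

lemma finite_tuples: "finite \<Sigma> \<Longrightarrow> finite (tuples \<Sigma> n)"
  by (simp add: tuples_def finite_PiE)

lemma tuples_nonempty: "\<Sigma> \<noteq> {} \<Longrightarrow> tuples \<Sigma> n \<noteq> {}"
  by (simp add: tuples_def PiE_eq_empty_iff)

lemma mix_in_tuples: "x \<in> tuples \<Sigma> n \<Longrightarrow> y \<in> tuples \<Sigma> n \<Longrightarrow> mix b x y \<in> tuples \<Sigma> n"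
  unfolding tuples_def mix_def PiE_iff extensional_def by simp

text \<open>From index \<open>n\<close> on both tuples are \<open>undefined\<close>, so exchanging
  the complement within the first \<open>n\<close> indices amounts to exchanging \<open>S\<close>
  with the roles of \<open>x\<close> and \<open>y\<close> reversed.\<close>

lemma mix_Compl:
  assumes "x \<in> tuples \<Sigma> n" "y \<in> tuples \<Sigma> n"
  shows "mix (\<lambda>i. i \<in> {..<n} - S) x y = mix (\<lambda>i. i \<in> S) y x"
  using assms unfolding tuples_def mix_def PiE_iff extensional_def by (intro ext) auto

lemma exch_commute: "exch \<Sigma> n S u v = exch \<Sigma> n S v u"
  unfolding exch_def by (subst sum.swap) (simp add: ac_simps)

lemma exch_avg_commute: "exch_avg \<Sigma> n u v = exch_avg \<Sigma> n v u"
  unfolding exch_avg_def by (simp only: exch_commute)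

lemma exch_Compl:
  "exch \<Sigma> n ({..<n} - S) u v = (\<Sum>x\<in>tuples \<Sigma> n. \<Sum>y\<in>tuples \<Sigma> n.
     u x * v y * cnj (u (mix (\<lambda>i. i \<in> S) y x) * v (mix (\<lambda>i. i \<in> S) x y)))"
  unfolding exch_def by (intro sum.cong refl) (simp only: mix_Compl)

lemma sum_mix:
  assumes "finite \<Sigma>"
  shows "(\<Sum>x\<in>tuples \<Sigma> n. \<Sum>y\<in>tuples \<Sigma> n. g (mix b x y) (mix b y x)) = (\<Sum>x\<in>tuples \<Sigma> n. \<Sum>y\<in>tuples \<Sigma> n. g x y)"
proof -
  let ?T = "tuples \<Sigma> n"
  have mm: "mix b (mix b x y) (mix b y x) = x" for x y :: "nat \<Rightarrow> 'a"
    by (auto simp: mix_def)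
  have "bij_betw (\<lambda>(x, y). (mix b x y, mix b y x)) (?T \<times> ?T) (?T \<times> ?T)"
    by (rule bij_betw_byWitness[where f' = "\<lambda>(x, y). (mix b x y, mix b y x)"])
       (simp_all add: mm mix_in_tuples image_subset_iff split: prod.split)
  from sum.reindex_bij_betw[OF this, of "\<lambda>(x, y). g x y"] show ?thesis
    by (simp add: sum.cartesian_product case_prod_unfold)
qed

text \<open>Adding a pattern \<open>S\<close> and its complement symmetrises \<open>u \<otimes> v\<close> under the exchange of both copies;
  the Cauchy-Schwarz loss then only involves the symmetrised vector, of squared norm
  \<open>2 (\<parallel>u\<parallel>\<^sup>2 \<parallel>v\<parallel>\<^sup>2 + \<bar>\<langle>u, v\<rangle>\<bar>\<^sup>2)\<close>.\<close>

lemma exch_pair_bound: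
  assumes "finite \<Sigma>"
  shows "Re (exch \<Sigma> n S u v) + Re (exch \<Sigma> n ({..<n} - S) u v)
    \<le> normsq (tuples \<Sigma> n) u * normsq (tuples \<Sigma> n) v + (cmod (ip (tuples \<Sigma> n) u v))\<^sup>2"
proof -
  let ?T = "tuples \<Sigma> n" and ?m = "mix (\<lambda>i. i \<in> S)"
  define W where "W x y = u x * v y + u y * v x" for x y
  define E where "E = exch \<Sigma> n S u v + exch \<Sigma> n ({..<n} - S) u v"
  have E1: "E = (\<Sum>x\<in>?T. \<Sum>y\<in>?T. u x * v y * cnj (W (?m x y) (?m y x)))"
    unfolding E_def exch_def[of _ _ S] exch_Compl sum.distrib[symmetric]
    by (intro sum.cong refl) (simp add: W_def algebra_simps)
  \<comment> \<open>\<open>W\<close> is symmetric, so renaming \<open>x\<close> and \<open>y\<close>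
    affects only the first factor; adding \<open>E1\<close> and \<open>E2\<close> turns it into
    \<open>W\<close>.\<close>
  have E2: "E = (\<Sum>x\<in>?T. \<Sum>y\<in>?T. u y * v x * cnj (W (?m x y) (?m y x)))"
    unfolding E1 by (subst sum.swap) (simp add: W_def ac_simps)
  have "E + E = (\<Sum>x\<in>?T. \<Sum>y\<in>?T. W x y * cnj (W (?m x y) (?m y x)))"
    by (subst (1) E1, subst E2) (simp only: sum.distrib[symmetric] distrib_right[symmetric] W_def)
  from arg_cong[OF this, of Re]
  have "2 * Re E = (\<Sum>x\<in>?T. \<Sum>y\<in>?T. Re (W x y * cnj (W (?m x y) (?m y x))))"
    by (simp only: Re_sum plus_complex.sel mult_2)
  also have "\<dots> \<le> (\<Sum>x\<in>?T. \<Sum>y\<in>?T. ((cmod (W x y))\<^sup>2 + (cmod (W (?m x y) (?m y x)))\<^sup>2) / 2)"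
  proof (intro sum_mono)
    fix x y
    have "Re (a * cnj b) \<le> ((cmod a)\<^sup>2 + (cmod b)\<^sup>2) / 2" for a b
    proof -
      have "Re (a * cnj b) \<le> cmod a * cmod b"
        using complex_Re_le_cmod[of "a * cnj b"] by (simp add: norm_mult)
      then show ?thesis using sum_squares_bound[of "cmod a" "cmod b"] by simp
    qed
    then show "Re (W x y * cnj (W (?m x y) (?m y x))) \<le> ((cmod (W x y))\<^sup>2 + (cmod (W (?m x y) (?m y x)))\<^sup>2) / 2" .
  qed
  also have "\<dots> = (\<Sum>x\<in>?T. \<Sum>y\<in>?T. (cmod (W x y))\<^sup>2)"
    unfolding add_divide_distrib sum.distrib sum_divide_distrib[symmetric]
    using sum_mix[OF assms, of "\<lambda>x y. (cmod (W x y))\<^sup>2" "\<lambda>i. i \<in> S"] by simp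
  also have "\<dots> = 2 * (normsq ?T u * normsq ?T v + (cmod (ip ?T u v))\<^sup>2)"
  proof -
    have "complex_of_real (\<Sum>x\<in>?T. \<Sum>y\<in>?T. (cmod (W x y))\<^sup>2)
      = (\<Sum>x\<in>?T. \<Sum>y\<in>?T. (u x * cnj (u x)) * (v y * cnj (v y)) + (v x * cnj (v x)) * (u y * cnj (u y))
           + (u x * cnj (v x)) * (v y * cnj (u y)) + (v x * cnj (u x)) * (u y * cnj (v y)))"
      unfolding of_real_sum complex_norm_square W_def
      by (intro sum.cong refl) (simp add: algebra_simps)
    also have "\<dots> = ip ?T u u * ip ?T v v + ip ?T v v * ip ?T u u + ip ?T u v * ip ?T v u + ip ?T v u * ip ?T u v"
      unfolding sum.distrib ip_def sum_product by simp
    also have "\<dots> = complex_of_real (2 * (normsq ?T u * normsq ?T v + (cmod (ip ?T u v))\<^sup>2))"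
      unfolding ip_self cnj_ip[of ?T u v, symmetric]
      by (simp add: complex_norm_square del: of_real_power)
    finally show ?thesis by (simp only: of_real_eq_iff)
  qed
  finally show ?thesis by (simp add: E_def)
qed

text \<open>Complementation permutes the patterns, so twice the sum over \<open>S\<close> is a sum
  of the pairs bounded in \<open>exch_pair_bound\<close>.\<close>

lemma exch_avg_bound:
  assumes "finite \<Sigma>"
  shows "Re (exch_avg \<Sigma> n u v)
    \<le> (normsq (tuples \<Sigma> n) u * normsq (tuples \<Sigma> n) v + (cmod (ip (tuples \<Sigma> n) u v))\<^sup>2) / 2"
    (is "_ \<le> ?B / 2")
proof -
  let ?R = "\<lambda>S. Re (exch \<Sigma> n S u v)"
  have "bij_betw (\<lambda>S. {..<n} - S) (Pow {..<n}) (Pow {..<n})"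
    by (rule bij_betw_byWitness[where f' = "\<lambda>S. {..<n} - S"]) auto
  from sum.reindex_bij_betw[OF this, of ?R]
  have "2 * (\<Sum>S\<in>Pow {..<n}. ?R S) = (\<Sum>S\<in>Pow {..<n}. ?R S + ?R ({..<n} - S))"
    by (simp add: sum.distrib)
  also have "\<dots> \<le> (\<Sum>S\<in>Pow {..<n}. ?B)"
    by (intro sum_mono exch_pair_bound assms)
  also have "\<dots> = 2 ^ n * ?B" by (simp add: card_Pow)
  finally have "(\<Sum>S\<in>Pow {..<n}. ?R S) / 2 ^ n \<le> ?B / 2"
    by (simp add: field_simps)
  moreover have "Re (exch_avg \<Sigma> n u v) = (\<Sum>S\<in>Pow {..<n}. ?R S) / 2 ^ n"
  proof -
    have "exch_avg \<Sigma> n u v = (\<Sum>S\<in>Pow {..<n}. exch \<Sigma> n S u v) / complex_of_real (2 ^ n)"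
      by (simp add: exch_avg_def)
    then show ?thesis by (simp only: Re_divide_of_real Re_sum)
  qed
  ultimately show ?thesis by simp
qed

text \<open>The sum over \<open>z\<close> sees the family \<open>F\<close> only through the kernel
  \<open>ker\<close>. There the cross terms between \<open>v\<close> and \<open>h\<close> vanish,
  because the coefficients \<open>k\<close> are orthogonal to \<open>h\<close> along
  \<open>z\<close>.\<close>

lemma exch_avg_decomp:
  assumes orth: "\<And>x. x \<in> tuples \<Sigma> n \<Longrightarrow> (\<Sum>z\<in>Z. cnj (k z) * h z x) = 0"
    and M: "(\<Sum>z\<in>Z. (cmod (k z))\<^sup>2) = M"
    and F: "\<And>z x. z \<in> Z \<Longrightarrow> x \<in> tuples \<Sigma> n \<Longrightarrow> F z x = k z * v x + h z x"
  shows "(\<Sum>z\<in>Z. exch_avg \<Sigma> n (F z) w) = of_real M * exch_avg \<Sigma> n v w + (\<Sum>z\<in>Z. exch_avg \<Sigma> n (h z) w)"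
proof -
  let ?T = "tuples \<Sigma> n"
  have ker: "(\<Sum>z\<in>Z. F z x * cnj (F z x')) = of_real M * (v x * cnj (v x')) + (\<Sum>z\<in>Z. h z x * cnj (h z x'))"
    if x: "x \<in> ?T" "x' \<in> ?T" for x x'
  proof -
    have "(\<Sum>z\<in>Z. F z x * cnj (F z x')) = (\<Sum>z\<in>Z. (k z * cnj (k z)) * (v x * cnj (v x'))
       + cnj (v x') * (cnj (k z) * h z x) + v x * cnj (cnj (k z) * h z x') + h z x * cnj (h z x'))"
      by (intro sum.cong refl) (simp add: F x algebra_simps)
    also have "\<dots> = (\<Sum>z\<in>Z. k z * cnj (k z)) * (v x * cnj (v x')) + cnj (v x') * (\<Sum>z\<in>Z. cnj (k z) * h z x)
       + v x * cnj (\<Sum>z\<in>Z. cnj (k z) * h z x') + (\<Sum>z\<in>Z. h z x * cnj (h z x'))"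
      by (simp only: sum.distrib sum_distrib_left sum_distrib_right cnj_sum)
    also have "(\<Sum>z\<in>Z. k z * cnj (k z)) = of_real M"
      unfolding M[symmetric] of_real_sum complex_norm_square ..
    finally show ?thesis using orth x by simp
  qed
  have gen: "(\<Sum>z\<in>Z. exch \<Sigma> n S (G z) w) = (\<Sum>x\<in>?T. \<Sum>y\<in>?T. w y * cnj (w (mix (\<lambda>i. i \<in> S) y x)) *
     (\<Sum>z\<in>Z. G z x * cnj (G z (mix (\<lambda>i. i \<in> S) x y))))" for S and G :: "'b \<Rightarrow> _"
    unfolding exch_def by (subst sum.swap, rule sum.cong[OF refl], subst sum.swap)
      (simp add: sum_distrib_left ac_simps)
  have one: "(\<Sum>z\<in>Z. exch \<Sigma> n S (F z) w) = of_real M * exch \<Sigma> n S v w + (\<Sum>z\<in>Z. exch \<Sigma> n S (h z) w)" for S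
    unfolding gen unfolding exch_def sum_distrib_left[of "of_real M"] sum.distrib[symmetric]
    by (intro sum.cong refl) (simp add: ker mix_in_tuples algebra_simps)
  have avg: "(\<Sum>z\<in>Z. exch_avg \<Sigma> n (G z) w) = (\<Sum>S\<in>Pow {..<n}. \<Sum>z\<in>Z. exch \<Sigma> n S (G z) w) / 2 ^ n" for G :: "'b \<Rightarrow> _"
    unfolding exch_avg_def sum_divide_distrib[symmetric] by (subst sum.swap) simp
  show ?thesis
    unfolding avg one exch_avg_def[of _ _ v] by (simp add: sum.distrib sum_distrib_left add_divide_distrib)
qed

section \<open>Slicing off the last coordinate\<close>

lemma sum_tuples_Suc:
  "(\<Sum>x\<in>tuples \<Sigma> (Suc n). g x) = (\<Sum>z\<in>\<Sigma>. \<Sum>x\<in>tuples \<Sigma> n. g (x(n := z)))"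
proof -
  have "tuples \<Sigma> (Suc n) = (\<lambda>(z, x). x(n := z)) ` (\<Sigma> \<times> tuples \<Sigma> n)"
    unfolding tuples_def lessThan_Suc PiE_insert_eq by simp
  moreover have "inj_on (\<lambda>(z, x). x(n := z)) (\<Sigma> \<times> tuples \<Sigma> n)"
    unfolding tuples_def by (rule inj_combinator) simp
  ultimately have "(\<Sum>x\<in>tuples \<Sigma> (Suc n). g x) = (\<Sum>(z, x)\<in>\<Sigma> \<times> tuples \<Sigma> n. g (x(n := z)))"
    by (simp add: sum.reindex case_prod_unfold)
  then show ?thesis by (simp add: sum.cartesian_product)
qed

text \<open>If \<open>S\<close> omits \<open>n\<close>, the last letters stay put and the slices are
  exchanged along \<open>S\<close>. If it contains \<open>n\<close>, they trade places, which is the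
  complementary exchange of the same slices. Both halves have equal sums, so the factor 2 turns
  \<open>2 ^ Suc n\<close> into \<open>2 ^ n\<close>.\<close>

lemma exch_avg_Suc:
  fixes f :: "(nat \<Rightarrow> 'a) \<Rightarrow> complex"
  shows "exch_avg \<Sigma> (Suc n) f f = (\<Sum>z\<in>\<Sigma>. \<Sum>w\<in>\<Sigma>. exch_avg \<Sigma> n (\<lambda>x. f (x(n := z))) (\<lambda>x. f (x(n := w))))"
proof -
  let ?T = "tuples \<Sigma> n" and ?F = "\<lambda>z x. f (x(n := z))"
  have mix_out: "mix (\<lambda>i. i \<in> S) (x(n := z)) (y(n := w)) = (mix (\<lambda>i. i \<in> S) x y)(n := z)"
    if "n \<notin> S" for S and x y :: "nat \<Rightarrow> 'a" and z w
    using that by (auto simp: mix_def)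
  have mix_in: "mix (\<lambda>i. i \<in> insert n S) (x(n := z)) (y(n := w)) = (mix (\<lambda>i. i \<in> S) x y)(n := w)"
    for S and x y :: "nat \<Rightarrow> 'a" and z w
    by (auto simp: mix_def)
  have out: "exch \<Sigma> (Suc n) S f f = (\<Sum>z\<in>\<Sigma>. \<Sum>w\<in>\<Sigma>. exch \<Sigma> n S (?F z) (?F w))" if "S \<in> Pow {..<n}" for S
  proof -
    have "n \<notin> S" using that by auto
    then show ?thesis
      unfolding exch_def[of _ "Suc n"] sum_tuples_Suc mix_out[OF \<open>n \<notin> S\<close>] unfolding exch_def
      by (intro sum.cong refl, subst sum.swap) simp
  qed
  have ins: "exch \<Sigma> (Suc n) (insert n S) f f = (\<Sum>z\<in>\<Sigma>. \<Sum>w\<in>\<Sigma>. exch \<Sigma> n ({..<n} - S) (?F z) (?F w))" for S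
    unfolding exch_def[of _ "Suc n"] sum_tuples_Suc mix_in exch_Compl
    by (intro sum.cong refl, subst sum.swap, intro sum.cong refl) (simp add: ac_simps)
  have "bij_betw (\<lambda>S. {..<n} - S) (Pow {..<n}) (Pow {..<n})"
    by (rule bij_betw_byWitness[where f' = "\<lambda>S. {..<n} - S"]) auto
  note refl_compl = sum.reindex_bij_betw[OF this]
  have "inj_on (insert n) (Pow {..<n})" by (rule inj_onI) (auto simp: insert_ident)
  moreover have "Pow {..<n} \<inter> insert n ` Pow {..<n} = {}" by auto
  ultimately have "(\<Sum>S\<in>Pow {..<Suc n}. exch \<Sigma> (Suc n) S f f)
     = (\<Sum>S\<in>Pow {..<n}. exch \<Sigma> (Suc n) S f f) + (\<Sum>S\<in>Pow {..<n}. exch \<Sigma> (Suc n) (insert n S) f f)"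
    unfolding lessThan_Suc Pow_insert by (subst sum.union_disjoint) (simp_all add: sum.reindex)
  also have "(\<Sum>S\<in>Pow {..<n}. exch \<Sigma> (Suc n) S f f) = (\<Sum>S\<in>Pow {..<n}. \<Sum>z\<in>\<Sigma>. \<Sum>w\<in>\<Sigma>. exch \<Sigma> n S (?F z) (?F w))"
    by (intro sum.cong refl out)
  also have "(\<Sum>S\<in>Pow {..<n}. exch \<Sigma> (Suc n) (insert n S) f f) = (\<Sum>S\<in>Pow {..<n}. \<Sum>z\<in>\<Sigma>. \<Sum>w\<in>\<Sigma>. exch \<Sigma> n S (?F z) (?F w))"
    unfolding ins by (rule refl_compl)
  finally have "exch_avg \<Sigma> (Suc n) f f = (\<Sum>S\<in>Pow {..<n}. \<Sum>z\<in>\<Sigma>. \<Sum>w\<in>\<Sigma>. exch \<Sigma> n S (?F z) (?F w)) / 2 ^ n"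
    (is "_ = ?X / _")
    unfolding exch_avg_def by (simp only: mult_2[symmetric] power_Suc mult_divide_mult_cancel_left) simp
  also have "(\<Sum>S\<in>Pow {..<n}. \<Sum>z\<in>\<Sigma>. \<Sum>w\<in>\<Sigma>. exch \<Sigma> n S (?F z) (?F w))
     = (\<Sum>z\<in>\<Sigma>. \<Sum>w\<in>\<Sigma>. \<Sum>S\<in>Pow {..<n}. exch \<Sigma> n S (?F z) (?F w))"
    by (subst sum.swap, rule sum.cong[OF refl], rule sum.swap)
  finally show ?thesis by (simp add: exch_avg_def sum_divide_distrib)
qed

section \<open>Projection onto a unit vector and the induction on coordinates\<close>

lemma normsq_decomp:
  assumes "normsq A v = 1"
  shows "normsq A u = (cmod (ip A u v))\<^sup>2 + normsq A (\<lambda>x. u x - ip A u v * v x)"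
    and "ip A (\<lambda>x. u x - ip A u v * v x) v = 0"
proof -
  let ?k = "ip A u v" and ?h = "\<lambda>x. u x - ip A u v * v x"
  show orth: "ip A ?h v = 0"
  proof -
    have "ip A ?h v = ?k - ?k * ip A v v"
      unfolding ip_def sum_distrib_left sum_subtractf[symmetric]
      by (intro sum.cong refl) (simp add: algebra_simps)
    then show ?thesis using assms by (simp add: ip_self)
  qed
  have "ip A u u = ?k * cnj ?k * ip A v v + cnj ?k * ip A ?h v + ?k * cnj (ip A ?h v) + ip A ?h ?h"
    unfolding ip_def[of A v v] ip_def[of A ?h] ip_def[of A u u] sum_distrib_left cnj_sum sum.distrib[symmetric]
    by (intro sum.cong refl) (simp add: algebra_simps)
  then have "complex_of_real (normsq A u) = of_real ((cmod ?k)\<^sup>2 + normsq A ?h)"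
    unfolding orth unfolding ip_self assms of_real_add complex_norm_square by simp
  then show "normsq A u = (cmod ?k)\<^sup>2 + normsq A ?h" by (simp only: of_real_eq_iff)
qed

lemma normsq_Suc: "normsq (tuples \<Sigma> (Suc n)) f = (\<Sum>z\<in>\<Sigma>. normsq (tuples \<Sigma> n) (\<lambda>x. f (x(n := z))))"
  by (simp only: normsq_def sum_tuples_Suc)

text \<open>Here \<open>s\<close> and \<open>t\<close> play the exchange averages of
  \<open>f\<close> and \<open>v\<close>. It suffices that (1 - d)^2 (s + d/2) is at most s - d; the
  difference factors, and its term 1/2 - 2c is the source of the threshold 3/4.\<close>

lemma defect_gain:
  fixes s t M :: real
  assumes "3/4 \<le> s" "2 * s - 1 \<le> M" "M \<le> 1" "s \<le> M\<^sup>2 * t + (1 - M)"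
  shows "s + (1 - M) / 2 \<le> t"
proof -
  define d where "d = 1 - M"
  define c where "c = 1 - s"
  have d: "0 \<le> d" "d \<le> 2 * c" and c: "c \<le> 1/4" using assms by (auto simp: c_def d_def)
  have "s - d - (1 - d)\<^sup>2 * (s + d / 2) = d * ((1/2 - 2 * c) + d * (c - d / 2))"
    unfolding c_def by (simp add: power2_eq_square field_simps)
  moreover have "d * ((1/2 - 2 * c) + d * (c - d / 2)) \<ge> 0"
    using d c by (intro mult_nonneg_nonneg add_nonneg_nonneg) auto
  moreover have "M = 1 - d" by (simp add: d_def)
  ultimately have "M\<^sup>2 * (s + d / 2) \<le> M\<^sup>2 * t" using assms(4) by auto
  moreover have "M\<^sup>2 > 0" using assms by simp
  ultimately have "s + d / 2 \<le> t" by (rule mult_left_le_imp_le)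
  then show ?thesis by (simp add: d_def)
qed

text \<open>The overlap is squared because each coordinate removed costs a factor \<open>M\<close>
  there. The threshold 3/4 passes to \<open>v\<close>, whose exchange average is at least that of
  \<open>f\<close>.\<close>

lemma product_overlap:
  assumes \<Sigma>: "finite \<Sigma>" "\<Sigma> \<noteq> {}"
    and "normsq (tuples \<Sigma> n) f = 1" "3/4 \<le> Re (exch_avg \<Sigma> n f f)"
  shows "\<exists>P. (\<forall>i<n. normsq \<Sigma> (P i) = 1) \<and>
    2 * Re (exch_avg \<Sigma> n f f) - 1 \<le> (cmod (ip (tuples \<Sigma> n) f (\<lambda>x. \<Prod>i<n. P i (x i))))\<^sup>2"
  using assms(3,4)
proof (induction n arbitrary: f)
  case 0
  \<comment> \<open>With one tuple and an empty product the squared overlap is \<open>normsq\<close>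
    of \<open>f\<close>, and no factor \<open>P i\<close> is constrained.\<close>
  have T: "tuples \<Sigma> 0 = {\<lambda>_. undefined}" by (simp add: tuples_def)
  have "Re (exch_avg \<Sigma> 0 f f) \<le> 1"
    using exch_avg_bound[OF \<Sigma>(1), of 0 f f] 0(1) by (simp add: ip_self)
  moreover have "(cmod (ip (tuples \<Sigma> 0) f (\<lambda>x. \<Prod>i<0. (undefined :: nat \<Rightarrow> 'a \<Rightarrow> complex) i (x i))))\<^sup>2 = 1"
    using 0(1) by (simp add: ip_def normsq_def T)
  ultimately show ?case by (intro exI[of _ undefined]) simp
next
  case (Suc n)
  let ?T = "tuples \<Sigma> n" and ?s = "Re (exch_avg \<Sigma> (Suc n) f f)"
  define F where "F z x = f (x(n := z))" for z x
  obtain v M where v: "normsq ?T v = 1" and M: "(\<Sum>z\<in>\<Sigma>. (cmod (ip ?T (F z) v))\<^sup>2) = M"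
    and top: "\<And>w. (\<Sum>z\<in>\<Sigma>. (cmod (ip ?T (F z) w))\<^sup>2) \<le> M * normsq ?T w"
    and eig: "\<And>x. x \<in> ?T \<Longrightarrow> (\<Sum>z\<in>\<Sigma>. cnj (ip ?T (F z) v) * F z x) = of_real M * v x"
    using exists_top_singular_vector[OF finite_tuples[OF \<Sigma>(1)] tuples_nonempty[OF \<Sigma>(2)] \<Sigma>(1), of n F]
    by blast
  define k where "k z = ip ?T (F z) v" for z
  define h where "h z x = F z x - k z * v x" for z x
  have F1: "(\<Sum>z\<in>\<Sigma>. normsq ?T (F z)) = 1"
    using Suc.prems(1) by (simp add: normsq_Suc F_def[abs_def])
  have hv: "ip ?T (h z) v = 0" and Fh: "normsq ?T (F z) = (cmod (k z))\<^sup>2 + normsq ?T (h z)" for z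
    using normsq_decomp[OF v, of "F z"] by (simp_all add: h_def[abs_def] k_def)
  have kM: "(\<Sum>z\<in>\<Sigma>. (cmod (k z))\<^sup>2) = M" using M by (simp add: k_def)
  have hM: "(\<Sum>z\<in>\<Sigma>. normsq ?T (h z)) = 1 - M"
    using F1 unfolding Fh sum.distrib kM by simp
  then have M1: "M \<le> 1" using sum_nonneg[of \<Sigma> "\<lambda>z. normsq ?T (h z)"] by simp
  \<comment> \<open>This is the eigenvalue equation for \<open>v\<close> again: besides
    \<open>h z\<close> being orthogonal to \<open>v\<close>, the coefficients \<open>k\<close> are
    orthogonal to \<open>h\<close> in the last coordinate.\<close>
  have orth: "(\<Sum>z\<in>\<Sigma>. cnj (k z) * h z x) = 0" if "x \<in> ?T" for x
  proof -
    have "(\<Sum>z\<in>\<Sigma>. cnj (k z) * h z x) = (\<Sum>z\<in>\<Sigma>. cnj (k z) * F z x) - (\<Sum>z\<in>\<Sigma>. k z * cnj (k z)) * v x"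
      unfolding sum_distrib_right sum_subtractf[symmetric]
      by (intro sum.cong refl) (simp add: h_def algebra_simps)
    also have "(\<Sum>z\<in>\<Sigma>. k z * cnj (k z)) = of_real M"
      unfolding kM[symmetric] of_real_sum complex_norm_square ..
    finally show ?thesis using eig[OF that] by (simp add: k_def)
  qed
  let ?N = "exch_avg \<Sigma> n"
  have s: "exch_avg \<Sigma> (Suc n) f f = (\<Sum>z\<in>\<Sigma>. \<Sum>w\<in>\<Sigma>. ?N (F z) (F w))"
    unfolding exch_avg_Suc F_def ..
  \<comment> \<open>The squared inner products of slices sum to the purity across the last
    coordinate, at most the top eigenvalue \<open>M\<close> since the slices have total squared norm
    1.\<close>
  have purity: "2 * ?s - 1 \<le> M"
  proof -
    have "?s \<le> (\<Sum>z\<in>\<Sigma>. \<Sum>w\<in>\<Sigma>. (normsq ?T (F z) * normsq ?T (F w) + (cmod (ip ?T (F z) (F w)))\<^sup>2) / 2)"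
      unfolding s Re_sum by (intro sum_mono exch_avg_bound \<Sigma>)
    also have "\<dots> = ((\<Sum>z\<in>\<Sigma>. normsq ?T (F z)) * (\<Sum>w\<in>\<Sigma>. normsq ?T (F w))
        + (\<Sum>w\<in>\<Sigma>. \<Sum>z\<in>\<Sigma>. (cmod (ip ?T (F z) (F w)))\<^sup>2)) / 2"
      unfolding sum_product sum.swap[of _ \<Sigma> \<Sigma>, of "\<lambda>w z. (cmod (ip ?T (F z) (F w)))\<^sup>2"]
      by (simp only: sum_divide_distrib[symmetric] sum.distrib)
    also have "\<dots> \<le> (1 + (\<Sum>w\<in>\<Sigma>. M * normsq ?T (F w))) / 2"
      unfolding F1 by (intro divide_right_mono add_mono sum_mono top) auto
    also have "\<dots> = (1 + M) / 2" unfolding sum_distrib_left[symmetric] F1 by simp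
    finally show ?thesis by simp
  qed
  have dec: "(\<Sum>z\<in>\<Sigma>. ?N (F z) w) = of_real M * ?N v w + (\<Sum>z\<in>\<Sigma>. ?N (h z) w)" for w
    by (rule exch_avg_decomp[OF orth kM]) (simp_all add: h_def)
  \<comment> \<open>The decomposition is applied to the first argument and, by commutativity, to the
    second.\<close>
  have "exch_avg \<Sigma> (Suc n) f f = (\<Sum>w\<in>\<Sigma>. \<Sum>z\<in>\<Sigma>. ?N (F z) (F w))"
    unfolding s by (rule sum.swap)
  also have "\<dots> = of_real M * (\<Sum>w\<in>\<Sigma>. ?N v (F w)) + (\<Sum>w\<in>\<Sigma>. \<Sum>z\<in>\<Sigma>. ?N (h z) (F w))"
    by (simp only: dec sum.distrib sum_distrib_left)
  also have "(\<Sum>w\<in>\<Sigma>. \<Sum>z\<in>\<Sigma>. ?N (h z) (F w)) = (\<Sum>z\<in>\<Sigma>. \<Sum>w\<in>\<Sigma>. ?N (F w) (h z))"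
    by (subst sum.swap) (intro sum.cong refl exch_avg_commute)
  also have "(\<Sum>w\<in>\<Sigma>. ?N v (F w)) = (\<Sum>w\<in>\<Sigma>. ?N (F w) v)"
    by (intro sum.cong refl exch_avg_commute)
  also have "\<dots> = of_real M * ?N v v + (\<Sum>z\<in>\<Sigma>. ?N v (h z))"
    unfolding dec by (simp only: exch_avg_commute[of _ _ "h _" v])
  also have "(\<Sum>z\<in>\<Sigma>. \<Sum>w\<in>\<Sigma>. ?N (F w) (h z))
      = of_real M * (\<Sum>z\<in>\<Sigma>. ?N v (h z)) + (\<Sum>z\<in>\<Sigma>. \<Sum>w\<in>\<Sigma>. ?N (h w) (h z))"
    by (simp only: dec sum.distrib sum_distrib_left)
  finally have s_eq: "?s = M\<^sup>2 * Re (?N v v) + 2 * M * (\<Sum>z\<in>\<Sigma>. Re (?N v (h z)))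
      + (\<Sum>z\<in>\<Sigma>. \<Sum>w\<in>\<Sigma>. Re (?N (h w) (h z)))"
    by (simp add: algebra_simps power2_eq_square)
  \<comment> \<open>Orthogonality of \<open>v\<close> and \<open>h z\<close> saves a factor 2 here,
    so that the mixed terms and the \<open>h\<close> terms together cost at most
    \<open>1 - M\<close>.\<close>
  have vh: "(\<Sum>z\<in>\<Sigma>. Re (?N v (h z))) \<le> (1 - M) / 2"
  proof -
    have "Re (?N v (h z)) \<le> normsq ?T (h z) / 2" for z
    proof -
      have "ip ?T v (h z) = 0" using hv[of z] cnj_ip[of ?T "h z" v] by simp
      then show ?thesis using exch_avg_bound[OF \<Sigma>(1), of n v "h z"] v by simp
    qed
    then have "(\<Sum>z\<in>\<Sigma>. Re (?N v (h z))) \<le> (\<Sum>z\<in>\<Sigma>. normsq ?T (h z) / 2)" by (intro sum_mono)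
    then show ?thesis by (simp add: hM flip: sum_divide_distrib)
  qed
  have hh: "(\<Sum>z\<in>\<Sigma>. \<Sum>w\<in>\<Sigma>. Re (?N (h w) (h z))) \<le> (1 - M)\<^sup>2"
  proof -
    have "Re (?N (h w) (h z)) \<le> normsq ?T (h z) * normsq ?T (h w)" for w z
      using exch_avg_bound[OF \<Sigma>(1), of n "h w" "h z"] ip_Cauchy_Schwarz[of ?T "h w" "h z"]
      by (simp add: mult.commute)
    then have "(\<Sum>z\<in>\<Sigma>. \<Sum>w\<in>\<Sigma>. Re (?N (h w) (h z))) \<le> (\<Sum>z\<in>\<Sigma>. \<Sum>w\<in>\<Sigma>. normsq ?T (h z) * normsq ?T (h w))"
      by (intro sum_mono)
    also have "\<dots> = (1 - M)\<^sup>2" unfolding sum_product[symmetric] hM by (simp add: power2_eq_square)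
    finally show ?thesis .
  qed
  have M_half: "M \<ge> 1/2" using purity Suc.prems(2) by simp
  have "2 * M * (\<Sum>z\<in>\<Sigma>. Re (?N v (h z))) \<le> 2 * M * ((1 - M) / 2)"
    using vh M_half by (intro mult_left_mono) auto
  moreover have "2 * M * ((1 - M) / 2) + (1 - M)\<^sup>2 = 1 - M"
    by (simp add: power2_eq_square field_simps)
  ultimately have "?s \<le> M\<^sup>2 * Re (?N v v) + (1 - M)"
    using hh unfolding s_eq by linarith
  from defect_gain[OF Suc.prems(2) purity M1 this]
  have gain: "?s + (1 - M) / 2 \<le> Re (?N v v)" .
  have "3/4 \<le> Re (?N v v)" using gain Suc.prems(2) M1 by argo
  from Suc.IH[OF v this] obtain P where P: "\<forall>i<n. normsq \<Sigma> (P i) = 1"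
    and ov: "2 * Re (?N v v) - 1 \<le> (cmod (ip ?T v (\<lambda>x. \<Prod>i<n. P i (x i))))\<^sup>2" by blast
  define p where "p x = (\<Prod>i<n. P i (x i))" for x
  \<comment> \<open>The last factor is \<open>k\<close>, of squared norm \<open>M\<close>, scaled to
    norm 1.\<close>
  define r where "r = complex_of_real (1 / sqrt M)"
  have r2: "(cmod r)\<^sup>2 = 1 / M"
    using M_half unfolding r_def norm_of_real by (simp add: power_divide)
  define P' where "P' = P(n := (\<lambda>z. r * k z))"
  have "normsq \<Sigma> (P' n) = 1"
    using M_half kM by (simp add: P'_def normsq_scale r2) (simp add: normsq_def)
  then have P'1: "\<forall>i<Suc n. normsq \<Sigma> (P' i) = 1"
    using P by (auto simp: less_Suc_eq P'_def)
  have prod: "(\<Prod>i<Suc n. P' i ((x(n := z)) i)) = p x * (r * k z)" for x z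
    by (simp add: P'_def p_def)
  have "ip (tuples \<Sigma> (Suc n)) f (\<lambda>x. \<Prod>i<Suc n. P' i (x i))
      = (\<Sum>z\<in>\<Sigma>. \<Sum>x\<in>?T. F z x * cnj (p x * (r * k z)))"
    unfolding ip_def sum_tuples_Suc prod F_def ..
  \<comment> \<open>Pairing with \<open>k\<close> in the last coordinate collapses the slices of
    \<open>f\<close> to \<open>M\<close> times \<open>v\<close>, so the squared overlap of
    \<open>v\<close> is multiplied by exactly \<open>M\<close>.\<close>
  also have "\<dots> = (\<Sum>x\<in>?T. cnj r * cnj (p x) * (\<Sum>z\<in>\<Sigma>. cnj (k z) * F z x))"
    unfolding sum_distrib_left by (subst sum.swap) (simp add: ac_simps)
  also have "\<dots> = (\<Sum>x\<in>?T. cnj r * cnj (p x) * (of_real M * v x))"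
    by (intro sum.cong refl) (simp only: k_def eig)
  also have "\<dots> = cnj r * of_real M * ip ?T v p"
    unfolding ip_def sum_distrib_left by (simp add: ac_simps)
  finally have "(cmod (ip (tuples \<Sigma> (Suc n)) f (\<lambda>x. \<Prod>i<Suc n. P' i (x i))))\<^sup>2
      = (cmod r)\<^sup>2 * M\<^sup>2 * (cmod (ip ?T v p))\<^sup>2"
    by (simp add: norm_mult power_mult_distrib)
  also have "\<dots> = M * (cmod (ip ?T v p))\<^sup>2"
    using M_half unfolding r2 by (simp add: power2_eq_square)
  finally have eq: "(cmod (ip (tuples \<Sigma> (Suc n)) f (\<lambda>x. \<Prod>i<Suc n. P' i (x i))))\<^sup>2 = M * (cmod (ip ?T v p))\<^sup>2" .
  \<comment> \<open>Expanding this product shows that the gain \<open>1 - M\<close> in the bound for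
    \<open>v\<close> pays for the factor \<open>M\<close>.\<close>
  have "0 \<le> (1 - M) * (M - (2 * ?s - 1))"
    using M1 purity by (intro mult_nonneg_nonneg) auto
  then have "2 * ?s - 1 \<le> M * (2 * ?s - 1 + (1 - M))" by (simp add: algebra_simps)
  also have "\<dots> \<le> M * (cmod (ip ?T v p))\<^sup>2"
    using M_half
  proof (intro mult_left_mono)
    show "2 * ?s - 1 + (1 - M) \<le> (cmod (ip ?T v p))\<^sup>2"
      using ov gain unfolding p_def by argo
  qed simp
  finally show ?case using P'1 eq by metis
qed

section \<open>From expectations to sums\<close>

lemma pair_pmf_of_set:
  assumes "finite A" "A \<noteq> {}" "finite B" "B \<noteq> {}"
  shows "pair_pmf (pmf_of_set A) (pmf_of_set B) = pmf_of_set (A \<times> B)"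
proof (rule pmf_eqI)
  fix z :: "'a \<times> 'b"
  obtain x y where z: "z = (x, y)" by (cases z)
  have "A \<times> B \<noteq> {}" "finite (A \<times> B)" using assms by auto
  then show "pmf (pair_pmf (pmf_of_set A) (pmf_of_set B)) z = pmf (pmf_of_set (A \<times> B)) z"
    using assms by (simp add: z pmf_pair pmf_of_set card_cartesian_product indicator_def)
qed

lemma expectation_pmf_of_set_complex:
  fixes g :: "'b \<Rightarrow> complex"
  assumes "finite A" "A \<noteq> {}"
  shows "measure_pmf.expectation (pmf_of_set A) g = sum g A / of_nat (card A)"
  using assms
  by (subst integral_measure_pmf[of A]) (auto simp: scaleR_conv_of_real sum_divide_distrib)

text \<open>Independent fair bits on the first \<open>n\<close> indices are the indicator of a
  uniform subset, so the expectation is a normalised sum over pairs of tuples and subsets.\<close>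

lemma swap_eq_exch_avg:
  assumes "finite \<Sigma>" "\<Sigma> \<noteq> {}"
  shows "swap \<Sigma> n f = exch_avg \<Sigma> n f f / (of_nat (card (tuples \<Sigma> n)))\<^sup>2"
proof -
  let ?T = "tuples \<Sigma> n" and ?B = "Pi_pmf {..<n} False (\<lambda>_. bernoulli_pmf (1/2))"
  let ?D = "?T \<times> ?T \<times> Pow {..<n}"
  define g where "g = (\<lambda>(x, y, S). f x * f y * cnj (f (mix (\<lambda>i. i \<in> S) x y) * f (mix (\<lambda>i. i \<in> S) y x)))"
  have T: "finite ?T" "?T \<noteq> {}" using assms by (auto simp: finite_tuples tuples_nonempty)
  have mix_eq: "mix (\<lambda>i. i < n \<and> b i) x y = mix b x y" if "x \<in> ?T" "y \<in> ?T" for b x y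
    using that unfolding tuples_def mix_def PiE_iff extensional_def by (intro ext) auto
  have "swap \<Sigma> n f = measure_pmf.expectation (swap_pmf \<Sigma> n) (\<lambda>(x, y, b). g (x, y, {i \<in> {..<n}. b i}))"
    unfolding swap_def
  proof (rule integral_cong_AE)
    show "AE z in measure_pmf (swap_pmf \<Sigma> n).
        (case z of (x, y, b) \<Rightarrow> f x * f y * cnj (f (mix b x y) * f (mix b y x)))
          = (case z of (x, y, b) \<Rightarrow> g (x, y, {i \<in> {..<n}. b i}))"
      unfolding AE_measure_pmf_iff swap_pmf_def g_def
      using T by (auto simp: mix_eq)
  qed simp_all
  also have "\<dots> = measure_pmf.expectation (map_pmf (\<lambda>(x, y, b). (x, y, {i \<in> {..<n}. b i})) (swap_pmf \<Sigma> n)) g"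
    by (simp add: case_prod_unfold)
  also have "map_pmf (\<lambda>(x, y, b). (x, y, {i \<in> {..<n}. b i})) (swap_pmf \<Sigma> n)
      = pair_pmf (pmf_of_set ?T) (pair_pmf (pmf_of_set ?T) (map_pmf (\<lambda>b. {i \<in> {..<n}. b i}) ?B))"
    unfolding swap_pmf_def pair_map_pmf2
    by (simp add: map_pmf_comp apsnd_def map_prod_def case_prod_unfold)
  also have "\<dots> = pmf_of_set ?D"
    unfolding pmf_of_set_Pow_conv_bernoulli[OF finite_lessThan]
    using pair_pmf_of_set[OF T, of "Pow {..<n}"] pair_pmf_of_set[OF T, of "?T \<times> Pow {..<n}"] T
    by (simp add: Pow_not_empty)
  also have "measure_pmf.expectation \<dots> g = sum g ?D / of_nat (card ?D)"
    using T by (intro expectation_pmf_of_set_complex) auto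
  also have "sum g ?D = (\<Sum>S\<in>Pow {..<n}. exch \<Sigma> n S f f)"
  proof -
    have "sum g ?D = (\<Sum>x\<in>?T. \<Sum>y\<in>?T. \<Sum>S\<in>Pow {..<n}. g (x, y, S))"
      by (simp add: sum.cartesian_product case_prod_unfold)
    also have "\<dots> = (\<Sum>x\<in>?T. \<Sum>S\<in>Pow {..<n}. \<Sum>y\<in>?T. g (x, y, S))"
      by (intro sum.cong refl sum.swap)
    also have "\<dots> = (\<Sum>S\<in>Pow {..<n}. \<Sum>x\<in>?T. \<Sum>y\<in>?T. g (x, y, S))"
      by (rule sum.swap)
    finally show ?thesis by (simp add: exch_def g_def)
  qed
  finally show ?thesis
    by (simp add: exch_avg_def card_cartesian_product card_Pow power2_eq_square ac_simps)
qed

section \<open>Normalisation and the final constants\<close>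

lemma l2_norm_eq: "finite A \<Longrightarrow> A \<noteq> {} \<Longrightarrow> l2_norm A u = sqrt (normsq A u / card A)"
  by (simp add: l2_norm_def unif_expectation_def normsq_def integral_pmf_of_set)

lemma l2_inner_eq: "finite A \<Longrightarrow> A \<noteq> {} \<Longrightarrow> l2_inner A u v = ip A u v / card A"
  by (simp add: l2_inner_def unif_expectation_def ip_def expectation_pmf_of_set_complex)

lemma exch_avg_scale:
  "exch_avg \<Sigma> n (\<lambda>x. of_real a * u x) (\<lambda>x. of_real a * u x) = of_real (a ^ 4) * exch_avg \<Sigma> n u u"
  unfolding exch_avg_def exch_def sum_distrib_left times_divide_eq_right
  by (simp add: power4_eq_xxxx ac_simps)

theorem theorem2p2:
  "\<exists>C::real. \<forall>(\<Sigma>::'a set) (n::nat) (f::(nat \<Rightarrow> 'a) \<Rightarrow> complex) (c::real).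
     finite \<Sigma> \<longrightarrow> \<Sigma> \<noteq> {} \<longrightarrow> l2_norm (tuples \<Sigma> n) f \<le> 1 \<longrightarrow> 0 \<le> c \<longrightarrow> c \<le> 0.05 \<longrightarrow>
     Re (swap \<Sigma> n f) \<ge> 1 - c \<longrightarrow>
     (\<exists>P::nat \<Rightarrow> 'a \<Rightarrow> complex. (\<forall>i<n. l2_norm \<Sigma> (P i) = 1) \<and>
        cmod (l2_inner (tuples \<Sigma> n) f (\<lambda>x. \<Prod>i<n. P i (x i))) \<ge> 1 - C * c)"
\<comment> \<open>The constant 3 is 1 for the norm deficit of \<open>f\<close> plus 2 from
  \<open>product_overlap\<close>, combined in \<open>(1 - c) * (1 - 2 * c)\<close>.\<close>
proof (intro exI[of _ 3] allI impI)
  fix \<Sigma> :: "'a set" and n and f :: "(nat \<Rightarrow> 'a) \<Rightarrow> complex" and c :: real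
  assume \<Sigma>: "finite \<Sigma>" "\<Sigma> \<noteq> {}" and f1: "l2_norm (tuples \<Sigma> n) f \<le> 1"
    and c: "0 \<le> c" "c \<le> 0.05" and sw: "1 - c \<le> Re (swap \<Sigma> n f)"
  let ?T = "tuples \<Sigma> n"
  have T: "finite ?T" "?T \<noteq> {}" using \<Sigma> by (auto simp: finite_tuples tuples_nonempty)
  define m where "m = real (card ?T)"
  define q where "q = real (card \<Sigma>)"
  have m0: "m > 0" using T by (simp add: m_def card_gt_0_iff)
  have q0: "q > 0" using \<Sigma> by (simp add: q_def card_gt_0_iff)
  have mq: "m = q ^ n" by (simp add: m_def q_def tuples_def card_PiE)
  \<comment> \<open>\<open>R\<close> is the squared uniform norm of \<open>f\<close>. It may be
    below 1, so the induction is applied to the rescaled \<open>u\<close>; since \<open>swap\<close>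
    is at most the square of \<open>R\<close>, the loss is bounded by \<open>c\<close>.\<close>
  define R where "R = normsq ?T f / m"
  have R: "0 \<le> R" "R \<le> 1"
    using f1 T m0 by (auto simp: R_def m_def l2_norm_eq)
  define E where "E = Re (exch_avg \<Sigma> n f f)"
  have swE: "Re (swap \<Sigma> n f) = E / m\<^sup>2"
  proof -
    have "swap \<Sigma> n f = exch_avg \<Sigma> n f f / complex_of_real (m\<^sup>2)"
      using swap_eq_exch_avg[OF \<Sigma>] by (simp add: m_def)
    then show ?thesis by (simp only: Re_divide_of_real E_def)
  qed
  have "E \<le> (normsq ?T f)\<^sup>2"
    using exch_avg_bound[OF \<Sigma>(1), of n f f] by (simp add: ip_self E_def power2_eq_square)
  then have ER: "E / m\<^sup>2 \<le> R\<^sup>2"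
    using m0 by (simp add: R_def power_divide divide_right_mono)
  then have Rc: "1 - c \<le> R\<^sup>2" using sw swE by simp
  also have R2: "R\<^sup>2 \<le> R" using R by (simp add: power2_eq_square mult_left_le)
  finally have Rc': "1 - c \<le> R" .
  then have R0: "R > 0" using c by simp
  define a where "a = 1 / sqrt (R * m)"
  define u where "u x = complex_of_real a * f x" for x
  have Rm: "R * m > 0" "normsq ?T f = R * m" using R0 m0 by (simp, simp add: R_def)
  have a: "a > 0" "a\<^sup>2 * (R * m) = 1" using Rm R0 m0 by (simp_all add: a_def power_divide)
  have a4: "a ^ 4 * (R\<^sup>2 * m\<^sup>2) = 1"
  proof -
    have "a ^ 4 * (R\<^sup>2 * m\<^sup>2) = (a\<^sup>2 * (R * m))\<^sup>2" by (simp add: power_mult_distrib flip: power_mult)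
    then show ?thesis using a by simp
  qed
  have u1: "normsq ?T u = 1" using a Rm(2) by (simp add: u_def[abs_def] normsq_scale)
  \<comment> \<open>The exchange average scales with the fourth power, so passing to
    \<open>u\<close> divides by the square of \<open>R\<close>, which can only increase this
    nonnegative value.\<close>
  have "1 - c \<le> E / m\<^sup>2" using sw swE by simp
  also have "\<dots> \<le> E / m\<^sup>2 / R\<^sup>2"
  proof -
    have "0 \<le> E / m\<^sup>2" using sw swE c by simp
    then have "E / m\<^sup>2 * R\<^sup>2 \<le> E / m\<^sup>2" using R by (intro mult_left_le power_le_one)
    then show ?thesis using R0 by (simp only: pos_le_divide_eq zero_less_power)
  qed
  also have "\<dots> = a ^ 4 * E" using a4 m0 R0 by (simp add: field_simps)
  also have "\<dots> = Re (exch_avg \<Sigma> n u u)"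
    unfolding u_def[abs_def] exch_avg_scale by (simp add: E_def)
  finally have su: "1 - c \<le> Re (exch_avg \<Sigma> n u u)" .
  with c have "3/4 \<le> Re (exch_avg \<Sigma> n u u)" by simp
  from product_overlap[OF \<Sigma> u1 this] obtain P where P: "\<forall>i<n. normsq \<Sigma> (P i) = 1"
    and ov: "2 * Re (exch_avg \<Sigma> n u u) - 1 \<le> (cmod (ip ?T u (\<lambda>x. \<Prod>i<n. P i (x i))))\<^sup>2" by blast
  define w where "w = cmod (ip ?T u (\<lambda>x. \<Prod>i<n. P i (x i)))"
  have w: "1 - 2 * c \<le> w"
  proof (cases "w \<le> 1")
    case True
    then have "w\<^sup>2 \<le> w" by (simp add: w_def power2_eq_square mult_left_le)
    then show ?thesis using ov su by (simp add: w_def)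
  qed (use c in simp)
  \<comment> \<open>Each factor \<open>sqrt q\<close> turns a unit vector for sums into one for
    expectations; the \<open>n\<close> factors multiply to \<open>sqrt m\<close>.\<close>
  define Q where "Q i z = complex_of_real (sqrt q) * P i z" for i z
  have "\<forall>i<n. l2_norm \<Sigma> (Q i) = 1"
    using P q0 \<Sigma> by (simp add: l2_norm_eq Q_def[abs_def] normsq_scale q_def[symmetric])
  moreover have "1 - 3 * c \<le> cmod (l2_inner ?T f (\<lambda>x. \<Prod>i<n. Q i (x i)))"
  proof -
    have "ip ?T f p = of_real (1 / a) * ip ?T u p" for p
      using a unfolding u_def ip_def sum_distrib_left by simp
    moreover have "(\<lambda>x. \<Prod>i<n. Q i (x i)) = (\<lambda>x. of_real (sqrt q ^ n) * (\<Prod>i<n. P i (x i)))"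
      by (simp add: Q_def prod.distrib)
    ultimately have "l2_inner ?T f (\<lambda>x. \<Prod>i<n. Q i (x i))
        = of_real (sqrt q ^ n) * (of_real (1 / a) * ip ?T u (\<lambda>x. \<Prod>i<n. P i (x i))) / of_real m"
      using T by (simp add: l2_inner_eq ip_scale_right m_def del: of_real_power)
    then have "cmod (l2_inner ?T f (\<lambda>x. \<Prod>i<n. Q i (x i))) = sqrt m * (1 / a) * w / m"
      using a m0 q0 by (simp add: norm_mult norm_divide norm_power w_def mq real_sqrt_power)
    also have "\<dots> = sqrt R * w"
      using R0 m0 by (simp add: a_def real_sqrt_mult field_simps)
    finally have eq: "cmod (l2_inner ?T f (\<lambda>x. \<Prod>i<n. Q i (x i))) = sqrt R * w" .
    have "1 - c \<le> sqrt R" using Rc' R2 real_le_rsqrt[OF R2] by simp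
    then have "(1 - c) * (1 - 2 * c) \<le> sqrt R * w"
      using w c R by (intro mult_mono) auto
    moreover have "1 - 3 * c \<le> (1 - c) * (1 - 2 * c)"
      using c by (simp add: algebra_simps)
    ultimately show ?thesis using eq by simp
  qed
  ultimately show "\<exists>P. (\<forall>i<n. l2_norm \<Sigma> (P i) = 1) \<and>
      1 - 3 * c \<le> cmod (l2_inner ?T f (\<lambda>x. \<Prod>i<n. P i (x i)))" by blast
qed

end
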